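(* Let $\Gamma$ be a simplicial graph, and let $\{G_i\}_{i\in V(\Gamma)}$ and $\{G_i'\}_{i\in V(\Gamma)}$ be two families of groups. Given a collection of injective set maps $f_i:G_i\to G'_i$, the induced homomorphism $$\Phi:(K_\Gamma,d_{nl})\longrightarrow(K'_\Gamma,d_{nl})$$ is an isometric embedding.
   Context: The graph product $G_\Gamma$ of groups $\{G_i\}_{i\in V(\Gamma)}$ is the quotient of the free product of the $G_i$ by the relations $[g_i,g_j]=1$ for $g_i\in G_i$, $g_j\in G_j$ whenever $\{i,j\}$ is an edge of $\Gamma$; $G'_\Gamma$ is the graph product of the $G'_i$. $K_\Gamma=\ker(G_\Gamma\to\prod_iG_i)$ and $K'_\Gamma=\ker(G'_\Gamma\to\prod_iG'_i)$, for the canonical epimorphisms which are the identity on each vertex group. A word is a finite product $w=g_1\cdots g_n$ of elements (syllables) of vertex groups; its length is $n$. Elementary moves on words: (1) remove a syllable equal to the identity of its vertex group; (2) replace two consecutive syllables $g_k,g_{k+1}$ in the same vertex group by the single syllable $g_kg_{k+1}$; (3) exchange consecutive syllables $g_k\in G_i$, $g_{k+1}\in G_j$ if $\{i,j\}$ is an edge of $\Gamma$. A word is in normal form if no sequence of elementary moves produces a strictly shorter word. The normal length $nl(g)$ of $g\in G_\Gamma$ is the length of a word in normal form representing $g$ (well defined, as normal forms are unique up to permutation of syllables). The normal length metric on $G_\Gamma$ is the left-invariant metric $d_{nl}(g,h)=nl(g^{-1}h)$; the same notation is used for its restriction to $K_\Gamma$, and likewise for $G'_\Gamma$, $K'_\Gamma$.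 The induced homomorphism $\Phi:K_\Gamma\to K'_\Gamma$ is given as follows. For $g\in K_\Gamma$ represented by a word $w$, let $g_{ij}$ be the $j$-th syllable (from the left) of $w$ from $G_i$; then $\Phi(g)$ is represented by the word obtained by replacing each syllable $g_{ij}$ by $f_i(g_{i1}\cdots g_{i,j-1})^{-1}f_i(g_{i1}\cdots g_{ij})\in G'_i$ in the same position, where the empty product (for $j=1$) is the identity $e_i$ of $G_i$. This is a well-defined homomorphism. *)

theory Defs
  imports Complex_Main "HOL-Algebra.Product_Groups" "HOL.Hull"
begin

definition simplicial_graph :: "'i set \<Rightarrow> 'i set set \<Rightarrow> bool" where
  "simplicial_graph V E \<longleftrightarrow> (\<forall>e\<in>E. e \<subseteq> V \<and> card e = 2)"

text \<open>
  A syllable is a pair \<open>(i, g)\<close> with \<open>g \<in> carrier (G i)\<close>. The tag \<open>i\<close> keeps the vertex groups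
  apart, so that no disjointness of their carriers has to be assumed.
\<close>

definition words :: "'i set \<Rightarrow> ('i \<Rightarrow> ('a, 'm) monoid_scheme) \<Rightarrow> ('i \<times> 'a) list set" where
  "words V G = lists (SIGMA i:V. carrier (G i))"

inductive cancel_move ::
    "'i set \<Rightarrow> ('i \<Rightarrow> ('a, 'm) monoid_scheme) \<Rightarrow> ('i \<times> 'a) list \<Rightarrow> ('i \<times> 'a) list \<Rightarrow> bool"
  for V G where
  remove: "u @ (i, \<one>\<^bsub>G i\<^esub>) # v \<in> words V G \<Longrightarrow>
           cancel_move V G (u @ (i, \<one>\<^bsub>G i\<^esub>) # v) (u @ v)"
| merge: "u @ (i, g) # (i, h) # v \<in> words V G \<Longrightarrow>
          cancel_move V G (u @ (i, g) # (i, h) # v) (u @ (i, g \<otimes>\<^bsub>G i\<^esub> h) # v)"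

inductive elementary_move ::
    "'i set \<Rightarrow> 'i set set \<Rightarrow> ('i \<Rightarrow> ('a, 'm) monoid_scheme) \<Rightarrow>
     ('i \<times> 'a) list \<Rightarrow> ('i \<times> 'a) list \<Rightarrow> bool"
  for V E G where
  cancel: "cancel_move V G u v \<Longrightarrow> elementary_move V E G u v"
| exchange: "\<lbrakk>u @ (i, g) # (j, h) # v \<in> words V G; {i, j} \<in> E\<rbrakk> \<Longrightarrow>
             elementary_move V E G (u @ (i, g) # (j, h) # v) (u @ (j, h) # (i, g) # v)"

definition normal_form ::
    "'i set \<Rightarrow> 'i set set \<Rightarrow> ('i \<Rightarrow> ('a, 'm) monoid_scheme) \<Rightarrow> ('i \<times> 'a) list \<Rightarrow> bool" where
  "normal_form V E G w \<longleftrightarrow> w \<in> words V G \<and>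
     \<not> (\<exists>w'. (elementary_move V E G)\<^sup>*\<^sup>* w w' \<and> length w' < length w)"

text \<open>
  The free product is the group of words under concatenation, modulo the equivalence relation
  generated by removing trivial syllables and multiplying adjacent syllables of the same group.
\<close>

definition free_product_rel ::
    "'i set \<Rightarrow> ('i \<Rightarrow> ('a, 'm) monoid_scheme) \<Rightarrow> (('i \<times> 'a) list \<times> ('i \<times> 'a) list) set" where
  "free_product_rel V G =
     {(u, v). u \<in> words V G \<and> v \<in> words V G \<and> equivclp (cancel_move V G) u v}"

definition free_product ::
    "'i set \<Rightarrow> ('i \<Rightarrow> ('a, 'm) monoid_scheme) \<Rightarrow> ('i \<times> 'a) list set monoid" where
  "free_product V G =
     \<lparr>carrier = words V G // free_product_rel V G,
      monoid.mult = (\<lambda>A B. \<Union>u\<in>A. \<Union>v\<in>B. free_product_rel V G `` {u @ v}),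
      one = free_product_rel V G `` {[]}\<rparr>"

definition free_product_of_word ::
    "'i set \<Rightarrow> ('i \<Rightarrow> ('a, 'm) monoid_scheme) \<Rightarrow> ('i \<times> 'a) list \<Rightarrow> ('i \<times> 'a) list set" where
  "free_product_of_word V G w = free_product_rel V G `` {w}"

definition normal_closure :: "('a, 'm) monoid_scheme \<Rightarrow> 'a set \<Rightarrow> 'a set" where
  "normal_closure G R = (\<lambda>N. N \<lhd> G) hull R"

definition group_commutator :: "('a, 'm) monoid_scheme \<Rightarrow> 'a \<Rightarrow> 'a \<Rightarrow> 'a" where
  "group_commutator G x y = x \<otimes>\<^bsub>G\<^esub> y \<otimes>\<^bsub>G\<^esub> inv\<^bsub>G\<^esub> x \<otimes>\<^bsub>G\<^esub> inv\<^bsub>G\<^esub> y"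

definition graph_product_relators ::
    "'i set \<Rightarrow> 'i set set \<Rightarrow> ('i \<Rightarrow> ('a, 'm) monoid_scheme) \<Rightarrow> ('i \<times> 'a) list set set" where
  "graph_product_relators V E G =
     {group_commutator (free_product V G)
        (free_product_of_word V G [(i, g)]) (free_product_of_word V G [(j, h)]) | i j g h.
        i \<in> V \<and> j \<in> V \<and> {i, j} \<in> E \<and> g \<in> carrier (G i) \<and> h \<in> carrier (G j)}"

definition graph_product ::
    "'i set \<Rightarrow> 'i set set \<Rightarrow> ('i \<Rightarrow> ('a, 'm) monoid_scheme) \<Rightarrow> ('i \<times> 'a) list set set monoid" where
  "graph_product V E G =
     free_product V G Mod normal_closure (free_product V G) (graph_product_relators V E G)"

text \<open>The element of the graph product represented by a word.\<close>

definition of_word ::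
    "'i set \<Rightarrow> 'i set set \<Rightarrow> ('i \<Rightarrow> ('a, 'm) monoid_scheme) \<Rightarrow> ('i \<times> 'a) list \<Rightarrow>
     ('i \<times> 'a) list set set" where
  "of_word V E G w =
     normal_closure (free_product V G) (graph_product_relators V E G)
       #>\<^bsub>free_product V G\<^esub> free_product_of_word V G w"

text \<open>
  The unique homomorphism to the direct product that is the identity on each vertex group.
  For infinite \<open>V\<close> its image is only the restricted product; the kernel does not depend on which
  of the two products is taken as codomain. Being \<open>extensional\<close> pins down the irrelevant values
  outside the carrier.
\<close>

definition canonical_projection ::
    "'i set \<Rightarrow> 'i set set \<Rightarrow> ('i \<Rightarrow> ('a, 'm) monoid_scheme) \<Rightarrow>
     ('i \<times> 'a) list set set \<Rightarrow> 'i \<Rightarrow> 'a" where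
  "canonical_projection V E G =
     (THE p. p \<in> hom (graph_product V E G) (product_group V G) \<and>
             p \<in> extensional (carrier (graph_product V E G)) \<and>
             (\<forall>i\<in>V. \<forall>g\<in>carrier (G i).
                p (of_word V E G [(i, g)]) = (\<lambda>j\<in>V. if j = i then g else \<one>\<^bsub>G j\<^esub>)))"

definition K_graph ::
    "'i set \<Rightarrow> 'i set set \<Rightarrow> ('i \<Rightarrow> ('a, 'm) monoid_scheme) \<Rightarrow> ('i \<times> 'a) list set set set" where
  "K_graph V E G = kernel (graph_product V E G) (product_group V G) (canonical_projection V E G)"

text \<open>
  The description operators in the definitions of \<open>nl\<close> and \<open>Phi\<close> take the common value
  over all admissible words, so independence of the chosen word is part of what they express.
\<close>

definition nl ::
    "'i set \<Rightarrow> 'i set set \<Rightarrow> ('i \<Rightarrow> ('a, 'm) monoid_scheme) \<Rightarrow> ('i \<times> 'a) list set set \<Rightarrow> nat" where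
  "nl V E G x = (THE n. \<exists>w. normal_form V E G w \<and> of_word V E G w = x \<and> length w = n)"

definition d_nl ::
    "'i set \<Rightarrow> 'i set set \<Rightarrow> ('i \<Rightarrow> ('a, 'm) monoid_scheme) \<Rightarrow>
     ('i \<times> 'a) list set set \<Rightarrow> ('i \<times> 'a) list set set \<Rightarrow> real" where
  "d_nl V E G x y =
     real (nl V E G (inv\<^bsub>graph_product V E G\<^esub> x \<otimes>\<^bsub>graph_product V E G\<^esub> y))"

text \<open>The product, from left to right, of the syllables of a word that belong to \<open>G i\<close>.\<close>

definition syllable_product ::
    "('i \<Rightarrow> ('a, 'm) monoid_scheme) \<Rightarrow> 'i \<Rightarrow> ('i \<times> 'a) list \<Rightarrow> 'a" where
  "syllable_product G i w = foldr (\<lambda>(j, g) x. if j = i then g \<otimes>\<^bsub>G i\<^esub> x else x) w \<one>\<^bsub>G i\<^esub>"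

definition Phi_word ::
    "('i \<Rightarrow> ('a, 'm) monoid_scheme) \<Rightarrow> ('i \<Rightarrow> ('b, 'n) monoid_scheme) \<Rightarrow> ('i \<Rightarrow> 'a \<Rightarrow> 'b) \<Rightarrow>
     ('i \<times> 'a) list \<Rightarrow> ('i \<times> 'b) list" where
  "Phi_word G G' f w =
     map (\<lambda>k. let i = fst (w ! k) in
            (i, inv\<^bsub>G' i\<^esub> (f i (syllable_product G i (take k w)))
                \<otimes>\<^bsub>G' i\<^esub> f i (syllable_product G i (take (Suc k) w))))
       [0..<length w]"

definition Phi ::
    "'i set \<Rightarrow> 'i set set \<Rightarrow> ('i \<Rightarrow> ('a, 'm) monoid_scheme) \<Rightarrow> ('i \<Rightarrow> ('b, 'n) monoid_scheme) \<Rightarrow>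
     ('i \<Rightarrow> 'a \<Rightarrow> 'b) \<Rightarrow> ('i \<times> 'a) list set set \<Rightarrow> ('i \<times> 'b) list set set" where
  "Phi V E G G' f x =
     (THE y. \<forall>w\<in>words V G. of_word V E G w = x \<longrightarrow> y = of_word V E G' (Phi_word G G' f w))"

definition isometric_embedding ::
    "'a set \<Rightarrow> ('a \<Rightarrow> 'a \<Rightarrow> real) \<Rightarrow> 'b set \<Rightarrow> ('b \<Rightarrow> 'b \<Rightarrow> real) \<Rightarrow> ('a \<Rightarrow> 'b) \<Rightarrow> bool" where
  "isometric_embedding M d M' d' F \<longleftrightarrow>
     F \<in> M \<rightarrow> M' \<and> (\<forall>x\<in>M. \<forall>y\<in>M. d' (F x) (F y) = d x y)"

end

theory Submission
  imports Defs
begin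

text \<open>
  Why \<open>\<Phi>\<close> preserves normal length. Rewriting a word syllable by syllable keeps the
  sequence of vertices, hence the length. The syllable \<open>g\<close> of \<open>G i\<close> that
  follows the partial product \<open>p\<close> becomes \<open>(f i p)\<inverse> \<cdot> f i (p g)\<close>, and
  three facts about this expression show that the moves available on a word and on its image are
  the same. Two consecutive ones telescope, so merges correspond to merges; exchanges correspond
  because different vertices do not see each other's partial products; and since \<open>f i\<close> is
  injective, the new syllable is trivial only if \<open>g\<close> is, so removals correspond as well.
  Consequently any sequence of moves starting at the image of \<open>w\<close> is the image of a
  sequence starting at \<open>w\<close>, and the image of a normal form is a normal form of the same
  length (\<open>normal_form_transport\<close>).

  This settles the claim once the normal length of an element can be read off from any of its
  normal forms. For this, two points are needed. First, words represent the same element of the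
  graph product exactly if they are connected by moves and their inverses
  (\<open>gp_class_eq_iff\<close>); here the presentation by a free product and a normal closure is
  taken apart. Second, equivalent normal forms have the same length
  (\<open>normal_form_length_unique\<close>). The proof is van der Waerden's: the syllables act by left
  multiplication on reduced words up to exchanges, the action respects all moves, and a reduced word
  is recovered by letting it act on the empty word.

  On the kernel all vertexwise products are trivial, so after a word of the kernel the partial
  products start afresh. Hence the rewriting is compatible with concatenation, which makes
  \<open>\<Phi>\<close> a homomorphism and reduces distances to normal lengths
  (\<open>nl_Phi\<close>).
\<close>

section \<open>Words and moves\<close>

locale vertex_groups =
  fixes V :: "'i set" and G :: "'i \<Rightarrow> ('a, 'm) monoid_scheme"
  assumes vertex_group: "i \<in> V \<Longrightarrow> group (G i)"
begin

abbreviation "W \<equiv> words V G"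

lemma words_Nil [simp]: "[] \<in> W"
  by (simp add: words_def)

lemma words_Cons [simp]: "(i, g) # w \<in> W \<longleftrightarrow> i \<in> V \<and> g \<in> carrier (G i) \<and> w \<in> W"
  by (auto simp: words_def)

lemma words_append [simp]: "u @ v \<in> W \<longleftrightarrow> u \<in> W \<and> v \<in> W"
  by (simp add: words_def)

lemma vertex_one [simp]: "i \<in> V \<Longrightarrow> \<one>\<^bsub>G i\<^esub> \<in> carrier (G i)"
  using vertex_group by (simp add: group.is_monoid monoid.one_closed)

lemma vertex_mult [simp]:
  "\<lbrakk>i \<in> V; g \<in> carrier (G i); h \<in> carrier (G i)\<rbrakk> \<Longrightarrow> g \<otimes>\<^bsub>G i\<^esub> h \<in> carrier (G i)"
  using vertex_group by (simp add: group.is_monoid monoid.m_closed)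

lemma vertex_inv [simp]:
  "\<lbrakk>i \<in> V; g \<in> carrier (G i)\<rbrakk> \<Longrightarrow> inv\<^bsub>G i\<^esub> g \<in> carrier (G i)"
  using vertex_group by (simp add: group.inv_closed)

lemma vertex_l_one [simp]: "\<lbrakk>i \<in> V; g \<in> carrier (G i)\<rbrakk> \<Longrightarrow> \<one>\<^bsub>G i\<^esub> \<otimes>\<^bsub>G i\<^esub> g = g"
  using vertex_group by (simp add: group.is_monoid monoid.l_one)

lemma vertex_r_one [simp]: "\<lbrakk>i \<in> V; g \<in> carrier (G i)\<rbrakk> \<Longrightarrow> g \<otimes>\<^bsub>G i\<^esub> \<one>\<^bsub>G i\<^esub> = g"
  using vertex_group by (simp add: group.is_monoid monoid.r_one)

lemma vertex_l_inv [simp]: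
  "\<lbrakk>i \<in> V; g \<in> carrier (G i)\<rbrakk> \<Longrightarrow> inv\<^bsub>G i\<^esub> g \<otimes>\<^bsub>G i\<^esub> g = \<one>\<^bsub>G i\<^esub>"
  using vertex_group by (simp add: group.l_inv)

lemma vertex_r_inv [simp]:
  "\<lbrakk>i \<in> V; g \<in> carrier (G i)\<rbrakk> \<Longrightarrow> g \<otimes>\<^bsub>G i\<^esub> inv\<^bsub>G i\<^esub> g = \<one>\<^bsub>G i\<^esub>"
  using vertex_group by (simp add: group.r_inv)

lemma vertex_assoc:
  "\<lbrakk>i \<in> V; g \<in> carrier (G i); h \<in> carrier (G i); k \<in> carrier (G i)\<rbrakk>
    \<Longrightarrow> g \<otimes>\<^bsub>G i\<^esub> h \<otimes>\<^bsub>G i\<^esub> k = g \<otimes>\<^bsub>G i\<^esub> (h \<otimes>\<^bsub>G i\<^esub> k)"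
  using vertex_group by (simp add: group.is_monoid monoid.m_assoc)

text \<open>
  The cancellation behind the induced map: consecutive quotients of values along a path compose to
  the quotient of the end values.
\<close>

lemma telescope:
  assumes "i \<in> V" "a \<in> carrier (G i)" "b \<in> carrier (G i)" "c \<in> carrier (G i)"
  shows "inv\<^bsub>G i\<^esub> a \<otimes>\<^bsub>G i\<^esub> b \<otimes>\<^bsub>G i\<^esub> (inv\<^bsub>G i\<^esub> b \<otimes>\<^bsub>G i\<^esub> c) = inv\<^bsub>G i\<^esub> a \<otimes>\<^bsub>G i\<^esub> c"
proof -
  have "b \<otimes>\<^bsub>G i\<^esub> (inv\<^bsub>G i\<^esub> b \<otimes>\<^bsub>G i\<^esub> c) = c"
    using assms by (simp flip: vertex_assoc)
  then show ?thesis using assms by (simp add: vertex_assoc)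
qed

text \<open>
  Equivalence of words under moves and their inverses. The empty edge set is the case of the free
  product, so the rules of calculation below serve the free product and the graph product alike.
\<close>

abbreviation word_equiv :: "'i set set \<Rightarrow> ('i \<times> 'a) list \<Rightarrow> ('i \<times> 'a) list \<Rightarrow> bool" where
  "word_equiv E \<equiv> equivclp (elementary_move V E G)"

lemma cancel_move_words: "cancel_move V G u v \<Longrightarrow> u \<in> W \<and> v \<in> W"
  by (auto elim!: cancel_move.cases)

lemma elementary_move_words: "elementary_move V E G u v \<Longrightarrow> u \<in> W \<and> v \<in> W"
  by (auto elim!: elementary_move.cases dest: cancel_move_words)

lemma elementary_moves_words:
  "\<lbrakk>(elementary_move V E G)\<^sup>*\<^sup>* u v; u \<in> W\<rbrakk> \<Longrightarrow> v \<in> W"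
  by (induction rule: rtranclp_induct) (auto dest: elementary_move_words)

lemma word_equiv_words: "\<lbrakk>word_equiv E u v; u \<in> W\<rbrakk> \<Longrightarrow> v \<in> W"
  by (induction rule: equivclp_induct) (auto dest: elementary_move_words)

lemma elementary_move_no_edges: "elementary_move V {} G = cancel_move V G"
  by (auto simp: fun_eq_iff elementary_move.simps)

lemma cancel_move_context:
  "\<lbrakk>cancel_move V G u v; x \<in> W; y \<in> W\<rbrakk> \<Longrightarrow> cancel_move V G (x @ u @ y) (x @ v @ y)"
proof (induction rule: cancel_move.induct)
  case (remove u i v)
  then show ?case using cancel_move.remove[of "x @ u" i G "v @ y" V] by simp
next
  case (merge u i g h v)
  then show ?case using cancel_move.merge[of "x @ u" i g h "v @ y" V G] by simp
qed

lemma elementary_move_context: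
  "\<lbrakk>elementary_move V E G u v; x \<in> W; y \<in> W\<rbrakk>
    \<Longrightarrow> elementary_move V E G (x @ u @ y) (x @ v @ y)"
proof (induction rule: elementary_move.induct)
  case (cancel u v)
  then show ?case by (simp add: cancel_move_context elementary_move.cancel)
next
  case (exchange u i g j h v)
  then show ?case using elementary_move.exchange[of "x @ u" i g j h "v @ y" V G E] by simp
qed

lemma elementary_moves_context:
  assumes "(elementary_move V E G)\<^sup>*\<^sup>* u v" "x \<in> W" "y \<in> W"
  shows "(elementary_move V E G)\<^sup>*\<^sup>* (x @ u @ y) (x @ v @ y)"
  using assms
  by (induction rule: rtranclp_induct) (auto intro: rtranclp.intros elementary_move_context)

lemma word_equiv_context:
  assumes "word_equiv E u v" "x \<in> W" "y \<in> W"
  shows "word_equiv E (x @ u @ y) (x @ v @ y)"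
  using assms
  by (induction rule: equivclp_induct)
    (auto intro: equivclp_into_equivclp elementary_move_context)

lemma word_equiv_append:
  assumes "word_equiv E u u'" "word_equiv E v v'" "u \<in> W" "v \<in> W"
  shows "word_equiv E (u @ v) (u' @ v')"
proof -
  have "word_equiv E (u @ v) (u' @ v)"
    using word_equiv_context[OF assms(1), of "[]" v] assms by simp
  also have "word_equiv E (u' @ v) (u' @ v')"
    using word_equiv_context[OF assms(2), of "u'" "[]"] word_equiv_words[OF assms(1,3)] by simp
  finally show ?thesis .
qed

lemma word_equiv_remove: "i \<in> V \<Longrightarrow> word_equiv E [(i, \<one>\<^bsub>G i\<^esub>)] []"
  using cancel_move.remove[of "[]" i G "[]" V] by (auto intro: elementary_move.cancel)

lemma word_equiv_merge:
  "\<lbrakk>i \<in> V; g \<in> carrier (G i); h \<in> carrier (G i)\<rbrakk>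
    \<Longrightarrow> word_equiv E [(i, g), (i, h)] [(i, g \<otimes>\<^bsub>G i\<^esub> h)]"
  using cancel_move.merge[of "[]" i g h "[]" V G] by (auto intro: elementary_move.cancel)

definition inverse_word :: "('i \<times> 'a) list \<Rightarrow> ('i \<times> 'a) list" where
  "inverse_word w = rev (map (\<lambda>(i, g). (i, inv\<^bsub>G i\<^esub> g)) w)"

lemma inverse_word_simps [simp]:
  "inverse_word [] = []"
  "inverse_word ((i, g) # w) = inverse_word w @ [(i, inv\<^bsub>G i\<^esub> g)]"
  by (simp_all add: inverse_word_def)

lemma inverse_word_words [simp]: "w \<in> W \<Longrightarrow> inverse_word w \<in> W"
  by (induction w) auto

lemma word_equiv_l_inverse: "w \<in> W \<Longrightarrow> word_equiv E (inverse_word w @ w) []"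
proof (induction w)
  case (Cons x w)
  obtain i g where [simp]: "x = (i, g)" by (cases x)
  from Cons have i: "i \<in> V" "g \<in> carrier (G i)" "w \<in> W" by auto
  have "word_equiv E [(i, inv\<^bsub>G i\<^esub> g), (i, g)] []"
    using word_equiv_merge[of i "inv\<^bsub>G i\<^esub> g" g E] word_equiv_remove[of i E] i
    by (auto intro: equivclp_trans)
  from word_equiv_context[OF this, of "inverse_word w" w] i
  have "word_equiv E (inverse_word (x # w) @ x # w) (inverse_word w @ w)" by simp
  also have "word_equiv E (inverse_word w @ w) []" using Cons i by simp
  finally show ?case .
qed simp

lemma word_equiv_r_inverse: "w \<in> W \<Longrightarrow> word_equiv E (w @ inverse_word w) []"
proof (induction w)
  case (Cons x w)
  obtain i g where [simp]: "x = (i, g)" by (cases x)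
  from Cons have i: "i \<in> V" "g \<in> carrier (G i)" "w \<in> W" by auto
  have "word_equiv E (w @ inverse_word w) []" using Cons i by simp
  from word_equiv_context[OF this, of "[x]" "[(i, inv\<^bsub>G i\<^esub> g)]"] i
  have "word_equiv E (x # w @ inverse_word (x # w)) [(i, g), (i, inv\<^bsub>G i\<^esub> g)]"
    by (simp add: Cons)
  also have "word_equiv E [(i, g), (i, inv\<^bsub>G i\<^esub> g)] []"
    using word_equiv_merge[of i g "inv\<^bsub>G i\<^esub> g" E] word_equiv_remove[of i E] i
    by (auto intro: equivclp_trans)
  finally show ?case by simp
qed simp

section \<open>The free product\<close>

abbreviation "FP \<equiv> free_product V G"

abbreviation fp_class :: "('i \<times> 'a) list \<Rightarrow> ('i \<times> 'a) list set" where
  "fp_class \<equiv> free_product_of_word V G"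

lemma free_product_rel_iff:
  "(u, v) \<in> free_product_rel V G \<longleftrightarrow> u \<in> W \<and> v \<in> W \<and> word_equiv {} u v"
  by (simp add: free_product_rel_def elementary_move_no_edges)

lemma equiv_free_product_rel: "equiv W (free_product_rel V G)"
  by (rule equivI)
    (auto simp: refl_on_def free_product_rel_iff intro!: symI transI
      intro: equivclp_sym equivclp_trans)

lemma fp_class_eq_iff:
  "\<lbrakk>u \<in> W; v \<in> W\<rbrakk> \<Longrightarrow> fp_class u = fp_class v \<longleftrightarrow> word_equiv {} u v"
  using eq_equiv_class_iff[OF equiv_free_product_rel]
  by (simp add: free_product_of_word_def free_product_rel_iff)

lemma carrier_free_product: "carrier FP = fp_class ` W"
  by (auto simp: free_product_def free_product_of_word_def quotient_def)

lemma fp_class_carrier [simp]: "w \<in> W \<Longrightarrow> fp_class w \<in> carrier FP"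
  by (simp add: carrier_free_product)

lemma fp_class_append:
  "\<lbrakk>u \<in> W; v \<in> W\<rbrakk> \<Longrightarrow> fp_class u \<otimes>\<^bsub>FP\<^esub> fp_class v = fp_class (u @ v)"
proof -
  assume uv: "u \<in> W" "v \<in> W"
  have "(\<lambda>u v. free_product_rel V G `` {u @ v}) respects2 free_product_rel V G"
    by (rule congruent2I')
      (auto simp: free_product_rel_iff intro: word_equiv_append
        intro!: equiv_class_eq[OF equiv_free_product_rel])
  from UN_equiv_class2[OF equiv_free_product_rel equiv_free_product_rel this uv]
  show ?thesis by (simp add: free_product_of_word_def free_product_def)
qed

lemma fp_one: "\<one>\<^bsub>FP\<^esub> = fp_class []"
  by (simp add: free_product_def free_product_of_word_def)

lemma group_free_product: "group FP"
proof (rule groupI)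
  fix x y z assume "x \<in> carrier FP" "y \<in> carrier FP" "z \<in> carrier FP"
  then show "x \<otimes>\<^bsub>FP\<^esub> y \<otimes>\<^bsub>FP\<^esub> z = x \<otimes>\<^bsub>FP\<^esub> (y \<otimes>\<^bsub>FP\<^esub> z)"
    by (auto simp: carrier_free_product fp_class_append)
next
  fix x assume "x \<in> carrier FP"
  then obtain w where w: "w \<in> W" "x = fp_class w" by (auto simp: carrier_free_product)
  have "fp_class (inverse_word w) \<otimes>\<^bsub>FP\<^esub> x = \<one>\<^bsub>FP\<^esub>"
    using w by (simp add: fp_class_append fp_one fp_class_eq_iff word_equiv_l_inverse)
  then show "\<exists>y\<in>carrier FP. y \<otimes>\<^bsub>FP\<^esub> x = \<one>\<^bsub>FP\<^esub>"
    using w by (metis fp_class_carrier inverse_word_words)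
qed (auto simp: carrier_free_product fp_class_append fp_one)

lemma fp_inv: "w \<in> W \<Longrightarrow> inv\<^bsub>FP\<^esub> (fp_class w) = fp_class (inverse_word w)"
  by (intro group.inv_equality[OF group_free_product])
    (simp_all add: fp_class_append fp_one fp_class_eq_iff word_equiv_l_inverse)

end

text \<open>
  The hull is an intersection, and an intersection of no subgroups would not be a subgroup; the
  carrier itself is a normal subgroup containing the given set.
\<close>

lemma (in group) normal_closure_normal:
  assumes "R \<subseteq> carrier G"
  shows "normal_closure G R \<lhd> G"
proof -
  let ?F = "{N. N \<lhd> G \<and> R \<subseteq> N}"
  have "carrier G \<lhd> G"
    by (simp add: normal_inv_iff subgroup_self)
  then have ne: "?F \<noteq> {}" using assms by auto
  have "subgroup (\<Inter>?F) G"
    using ne by (intro subgroups_Inter) (auto dest: normal_imp_subgroup)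
  then show ?thesis
    by (auto simp: normal_closure_def hull_def normal_inv_iff)
qed

lemma normal_closure_subset: "\<lbrakk>R \<subseteq> N; N \<lhd> G\<rbrakk> \<Longrightarrow> normal_closure G R \<subseteq> N"
  by (simp add: normal_closure_def hull_minimal)

lemma normal_closure_contains: "R \<subseteq> normal_closure G R"
  by (simp add: normal_closure_def hull_subset)

section \<open>The graph product\<close>

locale graph_of_groups = vertex_groups V G
  for V :: "'i set" and G :: "'i \<Rightarrow> ('a, 'm) monoid_scheme" +
  fixes E :: "'i set set"
  assumes simplicial: "simplicial_graph V E"
begin

lemma edge_vertices: "{i, j} \<in> E \<Longrightarrow> i \<in> V \<and> j \<in> V \<and> i \<noteq> j"
  using simplicial by (force simp: simplicial_graph_def)

abbreviation "GP \<equiv> graph_product V E G"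
abbreviation "gp_class \<equiv> of_word V E G"
abbreviation "N \<equiv> normal_closure FP (graph_product_relators V E G)"

lemma relator_eq:
  assumes "i \<in> V" "j \<in> V" "g \<in> carrier (G i)" "h \<in> carrier (G j)"
  shows "group_commutator FP (fp_class [(i, g)]) (fp_class [(j, h)])
       = fp_class ([(i, g), (j, h)] @ inverse_word [(j, h), (i, g)])"
  using assms by (simp add: group_commutator_def fp_inv fp_class_append)

lemma N_normal: "N \<lhd> FP"
  by (rule group.normal_closure_normal[OF group_free_product])
    (auto simp: graph_product_relators_def relator_eq)

lemma group_graph_product: "group GP"
  unfolding graph_product_def by (rule normal.factorgroup_is_group[OF N_normal])

lemma carrier_graph_product: "carrier GP = gp_class ` W"
  by (auto simp: graph_product_def FactGroup_def RCOSETS_def of_word_def carrier_free_product)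

lemma gp_class_carrier [simp]: "w \<in> W \<Longrightarrow> gp_class w \<in> carrier GP"
  by (simp add: carrier_graph_product)

lemma gp_class_append:
  "\<lbrakk>u \<in> W; v \<in> W\<rbrakk> \<Longrightarrow> gp_class u \<otimes>\<^bsub>GP\<^esub> gp_class v = gp_class (u @ v)"
  using normal.rcos_sum[OF N_normal, of "fp_class u" "fp_class v"]
  by (simp add: graph_product_def FactGroup_def of_word_def fp_class_append)

lemma gp_one: "\<one>\<^bsub>GP\<^esub> = gp_class []"
  using group.coset_mult_one[OF group_free_product, of N] N_normal
  by (simp add: graph_product_def FactGroup_def of_word_def fp_one[symmetric]
      normal_imp_subgroup subgroup.subset)

lemma gp_class_exchange:
  assumes "{i, j} \<in> E" "g \<in> carrier (G i)" "h \<in> carrier (G j)"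
  shows "gp_class [(i, g), (j, h)] = gp_class [(j, h), (i, g)]"
proof -
  interpret F: group FP by (rule group_free_product)
  have ij: "i \<in> V" "j \<in> V" using edge_vertices assms by auto
  let ?a = "fp_class [(i, g), (j, h)]" and ?b = "fp_class [(j, h), (i, g)]"
  have "?a \<otimes>\<^bsub>FP\<^esub> inv\<^bsub>FP\<^esub> ?b \<in> graph_product_relators V E G"
  proof -
    have "?a \<otimes>\<^bsub>FP\<^esub> inv\<^bsub>FP\<^esub> ?b
        = group_commutator FP (fp_class [(i, g)]) (fp_class [(j, h)])"
      using assms ij by (simp add: relator_eq fp_inv fp_class_append)
    then show ?thesis
      using assms ij unfolding graph_product_relators_def by blast
  qed
  then have "?a \<otimes>\<^bsub>FP\<^esub> inv\<^bsub>FP\<^esub> ?b \<in> N" by (rule subsetD[OF normal_closure_contains])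
  moreover have "?a = ?a \<otimes>\<^bsub>FP\<^esub> inv\<^bsub>FP\<^esub> ?b \<otimes>\<^bsub>FP\<^esub> ?b"
    using assms ij by (simp add: F.m_assoc)
  ultimately have "?a \<in> N #>\<^bsub>FP\<^esub> ?b" by (auto simp: r_coset_def)
  then show ?thesis
    using F.repr_independence[of ?a N ?b] N_normal assms ij
    by (simp add: of_word_def normal_imp_subgroup)
qed

lemma word_equiv_gp_class:
  assumes "word_equiv E u v" "u \<in> W"
  shows "gp_class u = gp_class v"
proof -
  have step: "gp_class u = gp_class v" if "elementary_move V E G u v" for u v
    using that
  proof (cases rule: elementary_move.cases)
    case cancel
    then have "word_equiv {} u v" by (auto simp: elementary_move_no_edges)
    then show ?thesis
      using cancel_move_words[OF cancel] by (simp add: of_word_def fp_class_eq_iff[symmetric])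
  next
    case (exchange x i g j h y)
    then have "gp_class [(i, g), (j, h)] = gp_class [(j, h), (i, g)]"
      by (intro gp_class_exchange) auto
    then have "gp_class x \<otimes>\<^bsub>GP\<^esub> (gp_class [(i, g), (j, h)] \<otimes>\<^bsub>GP\<^esub> gp_class y)
             = gp_class x \<otimes>\<^bsub>GP\<^esub> (gp_class [(j, h), (i, g)] \<otimes>\<^bsub>GP\<^esub> gp_class y)"
      by simp
    then show ?thesis using exchange by (simp add: gp_class_append)
  qed
  show ?thesis
    using assms by (induction rule: equivclp_induct) (auto dest: step)
qed

lemma word_equiv_if_no_edges: "word_equiv {} u v \<Longrightarrow> word_equiv E u v"
  by (induction rule: equivclp_induct)
    (auto simp: elementary_move_no_edges intro: equivclp_into_equivclp elementary_move.cancel)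

text \<open>
  The normal closure of the commutators is contained in any normal subgroup containing them. The
  words equivalent to the empty one form such a subgroup, so two words that agree in the quotient
  are related by moves.
\<close>

lemma gp_class_word_equiv:
  assumes "gp_class u = gp_class v" and uv: "u \<in> W" "v \<in> W"
  shows "word_equiv E u v"
proof -
  interpret F: group FP by (rule group_free_product)
  define M where "M = fp_class ` {w \<in> W. word_equiv E w []}"
  have closed: "fp_class w \<in> M" if "word_equiv E w []" "w \<in> W" for w
    using that by (auto simp: M_def)
  have "subgroup M FP"
  proof (rule F.subgroupI)
    show "M \<subseteq> carrier FP" by (auto simp: M_def)
    show "M \<noteq> {}" by (auto simp: M_def intro: exI[of _ "[]"])
  next
    fix a assume "a \<in> M"
    then obtain w where w: "w \<in> W" "word_equiv E w []" "a = fp_class w" by (auto simp: M_def)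
    have "word_equiv E (inverse_word w @ w) (inverse_word w @ [])"
      using w by (intro word_equiv_append) auto
    then have "word_equiv E (inverse_word w) []"
      using word_equiv_l_inverse[of w E] w by (auto intro: equivclp_trans equivclp_sym)
    then show "inv\<^bsub>FP\<^esub> a \<in> M" using w by (auto simp: fp_inv intro: closed)
  next
    fix a b assume "a \<in> M" "b \<in> M"
    then show "a \<otimes>\<^bsub>FP\<^esub> b \<in> M"
      using word_equiv_append[of E _ "[]" _ "[]"]
      by (auto simp: M_def fp_class_append)
  qed
  moreover have "x \<otimes>\<^bsub>FP\<^esub> a \<otimes>\<^bsub>FP\<^esub> inv\<^bsub>FP\<^esub> x \<in> M" if xa: "x \<in> carrier FP" "a \<in> M" for x a
  proof -
    obtain w c where w: "w \<in> W" "x = fp_class w" "c \<in> W" "a = fp_class c" "word_equiv E c []"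
      using xa unfolding M_def carrier_free_product by blast
    have "word_equiv E (w @ c @ inverse_word w) (w @ [] @ inverse_word w)"
      using w by (intro word_equiv_context) auto
    then have "word_equiv E (w @ c @ inverse_word w) []"
      using word_equiv_r_inverse[of w E] w by (auto intro: equivclp_trans)
    then show ?thesis using w by (auto simp: fp_inv fp_class_append intro: closed)
  qed
  ultimately have "M \<lhd> FP" by (simp add: F.normal_inv_iff)
  moreover have "graph_product_relators V E G \<subseteq> M"
  proof
    fix r assume "r \<in> graph_product_relators V E G"
    then obtain i j g h where r: "i \<in> V" "j \<in> V" "{i, j} \<in> E" "g \<in> carrier (G i)"
        "h \<in> carrier (G j)"
        "r = fp_class ([(i, g), (j, h)] @ inverse_word [(j, h), (i, g)])"
      by (auto simp: graph_product_relators_def relator_eq)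
    have "word_equiv E [(i, g), (j, h)] [(j, h), (i, g)]"
      using r elementary_move.exchange[of "[]" i g j h "[]" V G E] by auto
    then have "word_equiv E ([(i, g), (j, h)] @ inverse_word [(j, h), (i, g)])
        ([(j, h), (i, g)] @ inverse_word [(j, h), (i, g)])"
      using r by (intro word_equiv_append) auto
    also have "word_equiv E \<dots> []"
      using r by (intro word_equiv_r_inverse) auto
    finally show "r \<in> M" using r by (auto intro: closed)
  qed
  ultimately have "N \<subseteq> M" by (intro normal_closure_subset)
  have "fp_class u \<in> N #>\<^bsub>FP\<^esub> fp_class u"
    using N_normal uv by (simp add: F.rcos_self normal_imp_subgroup)
  then have "fp_class u \<in> N #>\<^bsub>FP\<^esub> fp_class v"
    using assms by (simp add: of_word_def)
  then obtain n where "n \<in> N" "fp_class u = n \<otimes>\<^bsub>FP\<^esub> fp_class v"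
    by (auto simp: r_coset_def)
  then obtain c where c: "c \<in> W" "word_equiv E c []" "fp_class u = fp_class (c @ v)"
    using \<open>N \<subseteq> M\<close> uv by (auto simp: M_def fp_class_append)
  then have "word_equiv E u (c @ v)"
    using uv by (auto simp: fp_class_eq_iff intro: word_equiv_if_no_edges)
  also have "word_equiv E (c @ v) v"
    using word_equiv_append[OF c(2), of v v] c uv by simp
  finally show ?thesis .
qed

lemma gp_class_eq_iff:
  "\<lbrakk>u \<in> W; v \<in> W\<rbrakk> \<Longrightarrow> gp_class u = gp_class v \<longleftrightarrow> word_equiv E u v"
  using gp_class_word_equiv word_equiv_gp_class by blast

lemma gp_inv: "w \<in> W \<Longrightarrow> inv\<^bsub>GP\<^esub> (gp_class w) = gp_class (inverse_word w)"
  by (intro group.inv_equality[OF group_graph_product])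
    (simp_all add: gp_class_append gp_one gp_class_eq_iff word_equiv_l_inverse)

end

section \<open>Uniqueness of normal forms\<close>

context graph_of_groups
begin

text \<open>
  Words up to exchanges only. Closure under \<open>Cons\<close> instead of closure under two-sided
  contexts lets inductions follow the recursion of the functions on words below, which read a word
  from the left.
\<close>

inductive shuffle :: "('i \<times> 'a) list \<Rightarrow> ('i \<times> 'a) list \<Rightarrow> bool" where
  refl: "shuffle w w"
| Cons: "shuffle u v \<Longrightarrow> shuffle (x # u) (x # v)"
| swap: "{i, j} \<in> E \<Longrightarrow> shuffle ((i, g) # (j, h) # w) ((j, h) # (i, g) # w)"
| trans [trans]: "\<lbrakk>shuffle u v; shuffle v w\<rbrakk> \<Longrightarrow> shuffle u w"

lemma shuffle_sym: "shuffle u v \<Longrightarrow> shuffle v u"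
  by (induction rule: shuffle.induct) (auto intro: shuffle.intros simp: insert_commute)

lemma shuffle_length: "shuffle u v \<Longrightarrow> length u = length v"
  by (induction rule: shuffle.induct) auto

lemma shuffle_words: "shuffle u v \<Longrightarrow> u \<in> W \<longleftrightarrow> v \<in> W"
  by (induction rule: shuffle.induct) auto

lemma shuffle_moves: "\<lbrakk>shuffle u v; u \<in> W\<rbrakk> \<Longrightarrow> (elementary_move V E G)\<^sup>*\<^sup>* u v"
proof (induction rule: shuffle.induct)
  case (Cons u v x)
  obtain i g where x: "x = (i, g)" by (cases x)
  with Cons have "(elementary_move V E G)\<^sup>*\<^sup>* u v" "[x] \<in> W" by auto
  from elementary_moves_context[OF this words_Nil] show ?case by simp
next
  case (swap i j g h w)
  then show ?case
    using elementary_move.exchange[of "[]" i g j h w V G E] by auto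
next
  case (trans u v w)
  then show ?case by (auto simp: shuffle_words intro: rtranclp_trans)
qed auto

text \<open>
  A word can be shuffled so that it begins with its first syllable from \<open>G i\<close> if every
  syllable before that one lies at a neighbour of \<open>i\<close>. Then \<open>front i w\<close> is
  this syllable and \<open>rest i w\<close> is the word without it; otherwise they are the identity
  and \<open>w\<close>.
\<close>

fun front :: "'i \<Rightarrow> ('i \<times> 'a) list \<Rightarrow> 'a" where
  "front i [] = \<one>\<^bsub>G i\<^esub>"
| "front i ((j, h) # w) =
    (if j = i then h else if {i, j} \<in> E then front i w else \<one>\<^bsub>G i\<^esub>)"

fun rest :: "'i \<Rightarrow> ('i \<times> 'a) list \<Rightarrow> ('i \<times> 'a) list" where
  "rest i [] = []"
| "rest i ((j, h) # w) =
    (if j = i then w else if {i, j} \<in> E then (j, h) # rest i w else (j, h) # w)"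

definition push :: "'i \<Rightarrow> 'a \<Rightarrow> ('i \<times> 'a) list \<Rightarrow> ('i \<times> 'a) list" where
  "push i g w = (if g = \<one>\<^bsub>G i\<^esub> then w else (i, g) # w)"

text \<open>
  Left multiplication by a syllable on reduced words. Dropping a trivial product in
  \<open>push\<close> keeps the word reduced.
\<close>

definition act :: "'i \<Rightarrow> 'a \<Rightarrow> ('i \<times> 'a) list \<Rightarrow> ('i \<times> 'a) list" where
  "act i g w = push i (g \<otimes>\<^bsub>G i\<^esub> front i w) (rest i w)"

text \<open>
  As all syllables are nontrivial, a trivial \<open>front\<close> says that no later syllable can be
  brought next to the one at hand and merged with it.
\<close>

fun reduced :: "('i \<times> 'a) list \<Rightarrow> bool" where
  "reduced [] \<longleftrightarrow> True"
| "reduced ((i, g) # w) \<longleftrightarrow> g \<noteq> \<one>\<^bsub>G i\<^esub> \<and> front i w = \<one>\<^bsub>G i\<^esub> \<and> reduced w"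

fun normalise :: "('i \<times> 'a) list \<Rightarrow> ('i \<times> 'a) list" where
  "normalise [] = []"
| "normalise ((i, g) # w) = act i g (normalise w)"

lemma front_carrier [simp]: "\<lbrakk>w \<in> W; i \<in> V\<rbrakk> \<Longrightarrow> front i w \<in> carrier (G i)"
  by (induction i w rule: front.induct) auto

lemma rest_words [simp]: "w \<in> W \<Longrightarrow> rest i w \<in> W"
  by (induction i w rule: rest.induct) auto

lemma push_words [simp]: "\<lbrakk>w \<in> W; i \<in> V; g \<in> carrier (G i)\<rbrakk> \<Longrightarrow> push i g w \<in> W"
  by (simp add: push_def)

lemma act_words [simp]: "\<lbrakk>w \<in> W; i \<in> V; g \<in> carrier (G i)\<rbrakk> \<Longrightarrow> act i g w \<in> W"
  by (simp add: act_def)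

lemma normalise_words [simp]: "w \<in> W \<Longrightarrow> normalise w \<in> W"
  by (induction w rule: normalise.induct) auto

text \<open>
  An exchange inside a word does not change which syllable can be brought to the front: two exchanged
  syllables lie at different vertices, and one of them passes the other either way. So the action is
  defined on words up to exchanges.
\<close>

lemma front_shuffle: "shuffle u v \<Longrightarrow> front i u = front i v"
proof (induction rule: shuffle.induct)
  case (Cons u v x)
  then show ?case by (cases x) auto
next
  case (swap j k g h w)
  then show ?case using edge_vertices[of j k] by (auto simp: insert_commute)
qed auto

lemma rest_shuffle: "shuffle u v \<Longrightarrow> shuffle (rest i u) (rest i v)"
proof (induction rule: shuffle.induct)
  case (Cons u v x)
  then show ?case by (cases x) (auto intro: shuffle.Cons)
next
  case (swap j k g h w)
  then show ?case
    using edge_vertices[of j k] by (auto simp: insert_commute intro: shuffle.refl shuffle.swap)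
qed (auto intro: shuffle.refl shuffle.trans)

lemma push_shuffle: "shuffle u v \<Longrightarrow> shuffle (push i g u) (push i g v)"
  by (simp add: push_def shuffle.Cons)

lemma act_shuffle: "shuffle u v \<Longrightarrow> shuffle (act i g u) (act i g v)"
  by (simp add: act_def front_shuffle rest_shuffle push_shuffle)

lemma push_commute: "{i, j} \<in> E \<Longrightarrow> shuffle (push i g (push j h w)) (push j h (push i g w))"
  by (simp add: push_def shuffle.refl shuffle.swap)

lemma front_rest_commute:
  assumes "{i, j} \<in> E"
  shows "front j (rest i w) = front j w" and "rest j (rest i w) = rest i (rest j w)"
  using assms edge_vertices[of i j]
  by (induction w rule: reduced.induct) (auto simp: insert_commute)

lemma rest_no_front: "\<lbrakk>reduced w; front i w = \<one>\<^bsub>G i\<^esub>\<rbrakk> \<Longrightarrow> rest i w = w"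
  by (induction w rule: reduced.induct) (auto split: if_splits)

lemma front_rest_same: "reduced w \<Longrightarrow> front i (rest i w) = \<one>\<^bsub>G i\<^esub>"
  by (induction w rule: reduced.induct) auto

lemma reduced_rest: "reduced w \<Longrightarrow> reduced (rest i w)"
  by (induction w rule: reduced.induct) (auto simp: front_rest_commute)

lemma reduced_act: "reduced w \<Longrightarrow> reduced (act i g w)"
  by (simp add: act_def push_def reduced_rest front_rest_same)

lemma reduced_normalise: "reduced (normalise w)"
  by (induction w rule: normalise.induct) (auto simp: reduced_act)

lemma front_push_same: "front i w = \<one>\<^bsub>G i\<^esub> \<Longrightarrow> front i (push i g w) = g"
  by (simp add: push_def)

lemma rest_push_same:
  "\<lbrakk>reduced w; front i w = \<one>\<^bsub>G i\<^esub>\<rbrakk> \<Longrightarrow> rest i (push i g w) = w"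
  by (simp add: push_def rest_no_front)

lemma front_push_edge: "{i, j} \<in> E \<Longrightarrow> front i (push j h w) = front i w"
  using edge_vertices[of i j] by (auto simp: push_def)

lemma rest_push_edge: "{i, j} \<in> E \<Longrightarrow> rest i (push j h w) = push j h (rest i w)"
  using edge_vertices[of i j] by (auto simp: push_def)

text \<open>
  The first product leaves its syllable at the front, or nothing from \<open>G i\<close> there at
  all; either way the second product finds exactly this syllable.
\<close>

lemma act_mult:
  assumes "reduced w" "w \<in> W" "i \<in> V" "g \<in> carrier (G i)" "h \<in> carrier (G i)"
  shows "act i g (act i h w) = act i (g \<otimes>\<^bsub>G i\<^esub> h) w"
  using assms
  by (simp add: act_def front_push_same rest_push_same front_rest_same reduced_rest vertex_assoc)

lemma shuffle_front_rest: "reduced w \<Longrightarrow> shuffle (push i (front i w) (rest i w)) w"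
proof (induction w rule: reduced.induct)
  case (2 j h w)
  then have IH: "shuffle (push i (front i w) (rest i w)) w" by simp
  show ?case
  proof (cases "j \<noteq> i \<and> {i, j} \<in> E")
    case True
    then have "shuffle (push i (front i w) ((j, h) # rest i w))
                       ((j, h) # push i (front i w) (rest i w))"
      by (auto simp: push_def insert_commute intro: shuffle.refl shuffle.swap)
    moreover have "shuffle \<dots> ((j, h) # w)" using IH by (rule shuffle.Cons)
    ultimately have "shuffle (push i (front i w) ((j, h) # rest i w)) ((j, h) # w)"
      by (rule shuffle.trans)
    then show ?thesis using True by simp
  qed (use 2 in \<open>auto simp: push_def intro: shuffle.refl\<close>)
qed (simp add: push_def shuffle.refl)

lemma act_one: "\<lbrakk>reduced w; w \<in> W; i \<in> V\<rbrakk> \<Longrightarrow> shuffle (act i \<one>\<^bsub>G i\<^esub> w) w"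
  by (simp add: act_def shuffle_front_rest)

text \<open>
  For adjacent vertices, taking the front syllable for one of them and pushing one for the other do
  not interfere.
\<close>

lemma act_commute:
  assumes "{i, j} \<in> E"
  shows "shuffle (act i g (act j h w)) (act j h (act i g w))"
  using assms push_commute[OF assms]
  by (simp add: act_def insert_commute front_push_edge rest_push_edge front_rest_commute)

lemma normalise_append_shuffle:
  "shuffle (normalise u) (normalise v) \<Longrightarrow> shuffle (normalise (x @ u)) (normalise (x @ v))"
  by (induction x rule: normalise.induct) (auto intro: act_shuffle)

text \<open>
  Each elementary move holds as an identity for the action: removals by \<open>act_one\<close>, merges
  by \<open>act_mult\<close>, exchanges by \<open>act_commute\<close>. The part of the word to the
  left of the move acts afterwards and respects shuffles.
\<close>

lemma normalise_move:
  "elementary_move V E G u v \<Longrightarrow> shuffle (normalise u) (normalise v)"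
proof (induction rule: elementary_move.induct)
  case (cancel u v)
  then show ?case
  proof (induction rule: cancel_move.induct)
    case (remove u i v)
    then show ?case
      by (intro normalise_append_shuffle) (simp add: act_one reduced_normalise)
  next
    case (merge u i g h v)
    then show ?case
      by (intro normalise_append_shuffle) (simp add: act_mult reduced_normalise shuffle.refl)
  qed
next
  case (exchange u i g j h v)
  then show ?case
    by (intro normalise_append_shuffle) (simp add: act_commute)
qed

lemma normalise_word_equiv: "word_equiv E u v \<Longrightarrow> shuffle (normalise u) (normalise v)"
proof (induction rule: equivclp_induct)
  case (step v w)
  then have "shuffle (normalise v) (normalise w)"
    by (blast intro: normalise_move shuffle_sym)
  with step.IH show ?case by (rule shuffle.trans)
qed (rule shuffle.refl)

lemma normalise_reduced: "\<lbrakk>reduced w; w \<in> W\<rbrakk> \<Longrightarrow> normalise w = w"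
  by (induction w rule: normalise.induct) (auto simp: act_def push_def rest_no_front)

lemma front_nontrivial_shuffle:
  "front i w \<noteq> \<one>\<^bsub>G i\<^esub> \<Longrightarrow> shuffle w ((i, front i w) # rest i w)"
proof (induction w rule: reduced.induct)
  case (2 j h w)
  show ?case
  proof (cases "j = i")
    case False
    with 2 have ij: "{j, i} \<in> E" and "shuffle w ((i, front i w) # rest i w)"
      by (auto simp: insert_commute split: if_splits)
    then have "shuffle ((j, h) # w) ((j, h) # (i, front i w) # rest i w)"
      by (intro shuffle.Cons)
    also note shuffle.swap[OF ij]
    finally show ?thesis using False ij by (simp add: insert_commute)
  qed (simp add: shuffle.refl)
qed simp

text \<open>
  A violation of reducedness can be turned into a shorter word: remove the trivial syllable, or
  shuffle the later syllable to the front of its suffix and merge.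
\<close>

lemma unreduced_shortens:
  "\<lbrakk>w \<in> W; \<not> reduced w\<rbrakk>
    \<Longrightarrow> \<exists>w'. (elementary_move V E G)\<^sup>*\<^sup>* w w' \<and> length w' < length w"
proof (induction w rule: reduced.induct)
  case (2 i g w)
  consider "g = \<one>\<^bsub>G i\<^esub>" | "front i w \<noteq> \<one>\<^bsub>G i\<^esub>" | "\<not> reduced w" using 2 by auto
  then show ?case
  proof cases
    case 1
    then have "elementary_move V E G ((i, g) # w) w"
      using 2 cancel_move.remove[of "[]" i G w V] by (auto intro: elementary_move.cancel)
    then show ?thesis by auto
  next
    case 2
    let ?v = "(i, g) # (i, front i w) # rest i w"
    let ?w' = "(i, g \<otimes>\<^bsub>G i\<^esub> front i w) # rest i w"
    have sh: "shuffle ((i, g) # w) ?v"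
      using 2 by (intro shuffle.Cons front_nontrivial_shuffle)
    then have "(elementary_move V E G)\<^sup>*\<^sup>* ((i, g) # w) ?v"
      using "2.prems" by (intro shuffle_moves)
    also have "elementary_move V E G ?v ?w'"
      using "2.prems" cancel_move.merge[of "[]" i g "front i w" "rest i w" V G]
      by (auto intro: elementary_move.cancel)
    finally show ?thesis using shuffle_length[OF sh] by (auto intro!: exI[of _ ?w'])
  next
    case 3
    then obtain w' where w': "(elementary_move V E G)\<^sup>*\<^sup>* w w'" "length w' < length w"
      using "2.IH" "2.prems" by auto
    have "(elementary_move V E G)\<^sup>*\<^sup>* ((i, g) # w) ((i, g) # w')"
      using elementary_moves_context[OF w'(1), of "[(i, g)]" "[]"] "2.prems" by simp
    then show ?thesis using w'(2) by (auto intro!: exI[of _ "(i, g) # w'"])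
  qed
qed simp

lemma normal_form_reduced: "normal_form V E G w \<Longrightarrow> reduced w"
  using unreduced_shortens by (auto simp: normal_form_def)

lemma moves_word_equiv: "(elementary_move V E G)\<^sup>*\<^sup>* u v \<Longrightarrow> word_equiv E u v"
  by (rule predicate2D[OF rtranlcp_le_equivclp])

text \<open>
  Both words are reduced, so each is its own normalisation, and equivalent words have the same
  normalisation up to exchanges.
\<close>

theorem normal_form_length_unique:
  assumes "normal_form V E G u" "normal_form V E G v" "word_equiv E u v"
  shows "length u = length v"
proof -
  have "u \<in> W" "v \<in> W" using assms by (auto simp: normal_form_def)
  then have "shuffle u v"
    using normalise_word_equiv[OF assms(3)] assms(1,2)
    by (simp add: normalise_reduced normal_form_reduced)
  then show ?thesis by (rule shuffle_length)
qed

lemma normal_form_exists: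
  "w \<in> W \<Longrightarrow> \<exists>v. normal_form V E G v \<and> word_equiv E w v"
proof (induction w rule: length_induct)
  case (1 w)
  show ?case
  proof (cases "normal_form V E G w")
    case False
    then obtain w' where w': "(elementary_move V E G)\<^sup>*\<^sup>* w w'" "length w' < length w"
      using 1 by (auto simp: normal_form_def)
    moreover have "w' \<in> W" using w' 1 by (auto dest: elementary_moves_words)
    ultimately obtain v where "normal_form V E G v" "word_equiv E w' v" using 1 by blast
    then show ?thesis using w'(1) by (blast intro: equivclp_trans moves_word_equiv)
  qed auto
qed

lemma nl_eq_length:
  assumes "normal_form V E G v"
  shows "nl V E G (gp_class v) = length v"
  unfolding nl_def
proof (rule the_equality)
  fix n assume "\<exists>w. normal_form V E G w \<and> gp_class w = gp_class v \<and> length w = n"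
  then obtain w where w: "normal_form V E G w" "gp_class w = gp_class v" "length w = n" by blast
  moreover have "word_equiv E w v"
    using w assms by (intro gp_class_word_equiv) (auto simp: normal_form_def)
  ultimately show "n = length v" using normal_form_length_unique assms by blast
qed (use assms in blast)

end

section \<open>The kernel of the canonical projection\<close>

lemma syllable_product_simps [simp]:
  "syllable_product G i [] = \<one>\<^bsub>G i\<^esub>"
  "syllable_product G i ((j, g) # w) =
     (if j = i then g \<otimes>\<^bsub>G i\<^esub> syllable_product G i w else syllable_product G i w)"
  by (simp_all add: syllable_product_def)

context graph_of_groups
begin

abbreviation "sp \<equiv> syllable_product G"

lemma sp_carrier [simp]: "\<lbrakk>w \<in> W; i \<in> V\<rbrakk> \<Longrightarrow> sp i w \<in> carrier (G i)"
  by (induction w) auto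

lemma sp_append: "\<lbrakk>u \<in> W; v \<in> W; i \<in> V\<rbrakk> \<Longrightarrow> sp i (u @ v) = sp i u \<otimes>\<^bsub>G i\<^esub> sp i v"
  by (induction u) (auto simp: vertex_assoc)

lemma sp_move: "\<lbrakk>elementary_move V E G u v; i \<in> V\<rbrakk> \<Longrightarrow> sp i u = sp i v"
proof (induction rule: elementary_move.induct)
  case (cancel u v)
  then show ?case
    by (induction rule: cancel_move.induct) (auto simp: sp_append vertex_assoc)
next
  case (exchange u j g k h v)
  then show ?case using edge_vertices[of j k] by (auto simp: sp_append)
qed

lemma sp_word_equiv: "\<lbrakk>word_equiv E u v; i \<in> V\<rbrakk> \<Longrightarrow> sp i u = sp i v"
  by (induction rule: equivclp_induct) (auto dest: sp_move)

lemma sp_inverse_word: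
  assumes "w \<in> W" "i \<in> V" "sp i w = \<one>\<^bsub>G i\<^esub>"
  shows "sp i (inverse_word w) = \<one>\<^bsub>G i\<^esub>"
  using sp_word_equiv[OF word_equiv_l_inverse[of w E], of i] assms by (simp add: sp_append)

text \<open>
  The graph product is generated by the vertex groups, so the prescribed values on single syllables
  determine a homomorphism to the product; on a word it takes the product at each vertex.
\<close>

lemma hom_sp_unique:
  assumes hom: "p \<in> hom GP (product_group V G)"
    and gen: "\<forall>i\<in>V. \<forall>g\<in>carrier (G i).
      p (gp_class [(i, g)]) = (\<lambda>j\<in>V. if j = i then g else \<one>\<^bsub>G j\<^esub>)"
    and w: "w \<in> W"
  shows "p (gp_class w) = (\<lambda>i\<in>V. sp i w)"
  using w
proof (induction w)
  case Nil
  have "group (product_group V G)" by (simp add: vertex_group)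
  then have "p \<one>\<^bsub>GP\<^esub> = \<one>\<^bsub>product_group V G\<^esub>"
    using hom_one[OF hom group_graph_product] by simp
  then show ?case by (simp add: gp_one)
next
  case (Cons x w)
  obtain i g where x: "x = (i, g)" by (cases x)
  with Cons have i: "i \<in> V" "g \<in> carrier (G i)" "w \<in> W" by auto
  have "p (gp_class (x # w)) = p (gp_class [x] \<otimes>\<^bsub>GP\<^esub> gp_class w)"
    using i x by (simp add: gp_class_append)
  also have "\<dots> = p (gp_class [x]) \<otimes>\<^bsub>product_group V G\<^esub> p (gp_class w)"
    using i x by (intro hom_mult[OF hom]) auto
  also have "\<dots> = (\<lambda>j\<in>V. sp j (x # w))"
    using i x Cons.IH gen by (auto simp: fun_eq_iff restrict_def)
  finally show ?case .
qed

text \<open>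
  Uniqueness is \<open>hom_sp_unique\<close>. For existence, the vertexwise products of a chosen
  representing word do not depend on the choice, because no move changes them.
\<close>

lemma canonical_projection_gp_class:
  assumes "w \<in> W"
  shows "canonical_projection V E G (gp_class w) = (\<lambda>i\<in>V. sp i w)"
proof -
  define P where "P p \<longleftrightarrow> p \<in> hom GP (product_group V G) \<and> p \<in> extensional (carrier GP) \<and>
    (\<forall>i\<in>V. \<forall>g\<in>carrier (G i).
       p (gp_class [(i, g)]) = (\<lambda>j\<in>V. if j = i then g else \<one>\<^bsub>G j\<^esub>))" for p
  define p where "p = (\<lambda>x\<in>carrier GP. \<lambda>i\<in>V. sp i (SOME w. w \<in> W \<and> gp_class w = x))"
  have p: "p (gp_class w) = (\<lambda>i\<in>V. sp i w)" if "w \<in> W" for w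
  proof -
    let ?v = "SOME v. v \<in> W \<and> gp_class v = gp_class w"
    have "?v \<in> W \<and> gp_class ?v = gp_class w" by (rule someI[of _ w]) (simp add: that)
    then have "word_equiv E ?v w" using that by (intro gp_class_word_equiv) auto
    then show ?thesis using that by (auto simp: p_def fun_eq_iff restrict_def intro: sp_word_equiv)
  qed
  have "P p"
    unfolding P_def
  proof (intro conjI ballI)
    show "p \<in> hom GP (product_group V G)"
    proof (rule homI)
      fix x assume "x \<in> carrier GP"
      then show "p x \<in> carrier (product_group V G)"
        by (auto simp: carrier_graph_product p)
    next
      fix x y assume "x \<in> carrier GP" "y \<in> carrier GP"
      then show "p (x \<otimes>\<^bsub>GP\<^esub> y) = p x \<otimes>\<^bsub>product_group V G\<^esub> p y"
        by (auto simp: carrier_graph_product gp_class_append p sp_append fun_eq_iff restrict_def)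
    qed
    show "p \<in> extensional (carrier GP)" by (simp add: p_def)
  qed (auto simp: p fun_eq_iff restrict_def)
  moreover have "q = p" if "P q" for q
  proof (rule extensionalityI)
    show "q \<in> extensional (carrier GP)" "p \<in> extensional (carrier GP)"
      using that \<open>P p\<close> by (auto simp: P_def)
    show "q x = p x" if "x \<in> carrier GP" for x
      using that \<open>P q\<close> hom_sp_unique by (auto simp: P_def carrier_graph_product p)
  qed
  ultimately have "canonical_projection V E G = p"
    unfolding canonical_projection_def P_def[symmetric] by (rule the_equality)
  then show ?thesis using p assms by simp
qed

text \<open>
  By \<open>K_graph_eq\<close> these are the words that represent elements of the kernel.
\<close>

definition kernel_words :: "('i \<times> 'a) list set" where
  "kernel_words = {w \<in> W. \<forall>i\<in>V. sp i w = \<one>\<^bsub>G i\<^esub>}"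

lemma K_graph_eq: "K_graph V E G = gp_class ` kernel_words"
proof -
  have "(\<lambda>i\<in>V. sp i w) = (\<lambda>i\<in>V. \<one>\<^bsub>G i\<^esub>) \<longleftrightarrow> (\<forall>i\<in>V. sp i w = \<one>\<^bsub>G i\<^esub>)" for w
    by (auto simp: fun_eq_iff restrict_def)
  then show ?thesis
    by (auto simp: K_graph_def kernel_def kernel_words_def carrier_graph_product
        canonical_projection_gp_class)
qed

lemma kernel_words_W: "w \<in> kernel_words \<Longrightarrow> w \<in> W"
  by (simp add: kernel_words_def)

lemma kernel_words_inverse: "w \<in> kernel_words \<Longrightarrow> inverse_word w \<in> kernel_words"
  by (simp add: kernel_words_def sp_inverse_word)

end

section \<open>The induced map\<close>

locale vertex_injections =
  dom: graph_of_groups V G E + cod: graph_of_groups V G' E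
  for V :: "'i set" and G :: "'i \<Rightarrow> ('a, 'm) monoid_scheme"
    and G' :: "'i \<Rightarrow> ('b, 'n) monoid_scheme" and E :: "'i set set" +
  fixes f :: "'i \<Rightarrow> 'a \<Rightarrow> 'b"
  assumes f_carrier: "i \<in> V \<Longrightarrow> f i \<in> carrier (G i) \<rightarrow> carrier (G' i)"
    and f_inj: "i \<in> V \<Longrightarrow> inj_on (f i) (carrier (G i))"
begin

text \<open>
  A state assigns to each vertex the product of the syllables read so far.
\<close>

fun advance :: "('i \<Rightarrow> 'a) \<Rightarrow> ('i \<times> 'a) list \<Rightarrow> 'i \<Rightarrow> 'a" where
  "advance p [] = p"
| "advance p ((i, g) # w) = advance (p(i := p i \<otimes>\<^bsub>G i\<^esub> g)) w"

text \<open>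
  The induced map on words, as a left-to-right traversal. Starting from an arbitrary state, and not
  only from the identities, is what makes the map decompose along concatenations.
\<close>

fun transport :: "('i \<Rightarrow> 'a) \<Rightarrow> ('i \<times> 'a) list \<Rightarrow> ('i \<times> 'b) list" where
  "transport p [] = []"
| "transport p ((i, g) # w) =
     (i, inv\<^bsub>G' i\<^esub> (f i (p i)) \<otimes>\<^bsub>G' i\<^esub> f i (p i \<otimes>\<^bsub>G i\<^esub> g))
       # transport (p(i := p i \<otimes>\<^bsub>G i\<^esub> g)) w"

definition state :: "('i \<Rightarrow> 'a) \<Rightarrow> bool" where
  "state p \<longleftrightarrow> (\<forall>i\<in>V. p i \<in> carrier (G i))"

abbreviation "start \<equiv> \<lambda>i. \<one>\<^bsub>G i\<^esub>"

lemma f_closed [simp]: "\<lbrakk>i \<in> V; g \<in> carrier (G i)\<rbrakk> \<Longrightarrow> f i g \<in> carrier (G' i)"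
  using f_carrier by auto

lemma state_start [simp]: "state start"
  by (simp add: state_def)

lemma stateD [simp]: "\<lbrakk>state p; i \<in> V\<rbrakk> \<Longrightarrow> p i \<in> carrier (G i)"
  by (simp add: state_def)

lemma state_update [simp]: "\<lbrakk>state p; i \<in> V; g \<in> carrier (G i)\<rbrakk> \<Longrightarrow> state (p(i := g))"
  by (simp add: state_def)

lemma state_advance [simp]: "\<lbrakk>state p; w \<in> dom.W\<rbrakk> \<Longrightarrow> state (advance p w)"
  by (induction w arbitrary: p) auto

lemma advance_eq:
  "\<lbrakk>state p; w \<in> dom.W; i \<in> V\<rbrakk> \<Longrightarrow> advance p w i = p i \<otimes>\<^bsub>G i\<^esub> dom.sp i w"
  by (induction w arbitrary: p) (auto simp: dom.vertex_assoc)

lemma transport_append: "transport p (u @ v) = transport p u @ transport (advance p u) v"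
  by (induction u arbitrary: p) auto

lemma length_transport [simp]: "length (transport p w) = length w"
  by (induction w arbitrary: p) auto

lemma transport_words [simp]: "\<lbrakk>state p; w \<in> dom.W\<rbrakk> \<Longrightarrow> transport p w \<in> cod.W"
  by (induction w arbitrary: p) auto

lemma transport_cong:
  "\<lbrakk>\<And>i. i \<in> V \<Longrightarrow> p i = q i; w \<in> dom.W\<rbrakk> \<Longrightarrow> transport p w = transport q w"
proof (induction p w arbitrary: q rule: transport.induct)
  case (2 p i g w)
  have "transport (p(i := p i \<otimes>\<^bsub>G i\<^esub> g)) w = transport (q(i := q i \<otimes>\<^bsub>G i\<^esub> g)) w"
    by (rule "2.IH") (use "2.prems" in auto)
  then show ?case using "2.prems" by simp
qed simp

text \<open>
  The positionwise formula with prefixes agrees with the traversal, once the products of prefixes are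
  multiplied by the initial state.
\<close>

lemma map_partial_products:
  "\<lbrakk>state p; w \<in> dom.W\<rbrakk> \<Longrightarrow>
    map (\<lambda>k. let i = fst (w ! k) in
           (i, inv\<^bsub>G' i\<^esub> (f i (p i \<otimes>\<^bsub>G i\<^esub> dom.sp i (take k w)))
               \<otimes>\<^bsub>G' i\<^esub> f i (p i \<otimes>\<^bsub>G i\<^esub> dom.sp i (take (Suc k) w))))
      [0..<length w]
    = transport p w"
proof (induction p w rule: transport.induct)
  case (2 p j g w)
  let ?q = "p(j := p j \<otimes>\<^bsub>G j\<^esub> g)"
  have j: "j \<in> V" "g \<in> carrier (G j)" "w \<in> dom.W" using "2.prems" by auto
  have shift: "p i \<otimes>\<^bsub>G i\<^esub> dom.sp i (take (Suc k) ((j, g) # w)) = ?q i \<otimes>\<^bsub>G i\<^esub> dom.sp i (take k w)"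
    if "i \<in> V" for i k
  proof -
    have "take k w \<in> dom.W" using j(3) by (metis append_take_drop_id dom.words_append)
    then show ?thesis using that j \<open>state p\<close> by (auto simp: dom.vertex_assoc)
  qed
  have V: "fst (w ! k) \<in> V" if "k < length w" for k
    using j(3) that by (auto simp: words_def dest!: nth_mem)
  show ?case
    using j \<open>state p\<close> V "2.IH"[symmetric]
    by (simp add: map_upt_Suc shift Let_def fun_upd_same del: upt_Suc take_Suc_Cons fun_upd_apply cong: map_cong)
qed simp

lemma Phi_word_eq_transport:
  assumes "w \<in> dom.W"
  shows "Phi_word G G' f w = transport start w"
proof -
  have "take k w \<in> dom.W" for k using assms by (metis append_take_drop_id dom.words_append)
  moreover have "fst (w ! k) \<in> V" if "k < length w" for k
    using assms that by (auto simp: words_def dest!: nth_mem)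
  ultimately show ?thesis
    unfolding map_partial_products[OF state_start assms, symmetric] Phi_word_def
    by (intro map_cong refl) (simp add: Let_def)
qed

lemma sp_transport:
  "\<lbrakk>state p; w \<in> dom.W; i \<in> V\<rbrakk> \<Longrightarrow>
    cod.sp i (transport p w) = inv\<^bsub>G' i\<^esub> (f i (p i)) \<otimes>\<^bsub>G' i\<^esub> f i (p i \<otimes>\<^bsub>G i\<^esub> dom.sp i w)"
proof (induction w arbitrary: p)
  case (Cons x w)
  obtain j g where x: "x = (j, g)" by (cases x)
  let ?q = "p(j := p j \<otimes>\<^bsub>G j\<^esub> g)"
  have j: "j \<in> V" "g \<in> carrier (G j)" "w \<in> dom.W" using Cons.prems x by auto
  have IH: "cod.sp i (transport ?q w)
      = inv\<^bsub>G' i\<^esub> (f i (?q i)) \<otimes>\<^bsub>G' i\<^esub> f i (?q i \<otimes>\<^bsub>G i\<^esub> dom.sp i w)"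
    using Cons.prems j by (intro Cons.IH state_update) auto
  show ?case
  proof (cases "j = i")
    case True
    then show ?thesis
      using x j Cons.prems IH by (simp add: cod.telescope dom.vertex_assoc)
  next
    case False
    then show ?thesis using x IH by simp
  qed
qed simp

lemma transport_move:
  assumes "elementary_move V E G u v" "state p"
  shows "elementary_move V E G' (transport p u) (transport p v)"
  using assms
proof (induction rule: elementary_move.induct)
  case (cancel u v)
  then have "cancel_move V G' (transport p u) (transport p v)"
  proof (induction rule: cancel_move.induct)
    case (remove u i v)
    let ?q = "advance p u"
    have q: "state ?q" "i \<in> V" using remove by auto
    then have "?q(i := ?q i) = ?q" by simp
    then show ?case
      using remove q cancel_move.remove[of "transport p u" i G' "transport ?q v" V]
      by (simp add: transport_append)
  next
    case (merge u i g h v)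
    let ?q = "advance p u"
    have q: "state ?q" "i \<in> V" using merge by auto
    then show ?case
      using merge q cancel_move.merge[of "transport p u" i
          "inv\<^bsub>G' i\<^esub> (f i (?q i)) \<otimes>\<^bsub>G' i\<^esub> f i (?q i \<otimes>\<^bsub>G i\<^esub> g)"
          "inv\<^bsub>G' i\<^esub> (f i (?q i \<otimes>\<^bsub>G i\<^esub> g)) \<otimes>\<^bsub>G' i\<^esub> f i (?q i \<otimes>\<^bsub>G i\<^esub> g \<otimes>\<^bsub>G i\<^esub> h)"
          "transport (?q(i := ?q i \<otimes>\<^bsub>G i\<^esub> (g \<otimes>\<^bsub>G i\<^esub> h))) v" V G']
      by (simp add: transport_append cod.telescope dom.vertex_assoc)
  qed
  then show ?case by (rule elementary_move.cancel)
next
  case (exchange u i g j h v)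
  let ?q = "advance p u"
  have q: "state ?q" "i \<in> V" "j \<in> V" "i \<noteq> j"
    using exchange dom.edge_vertices[of i j] by auto
  then show ?case
    using exchange elementary_move.exchange[of "transport p u" i
        "inv\<^bsub>G' i\<^esub> (f i (?q i)) \<otimes>\<^bsub>G' i\<^esub> f i (?q i \<otimes>\<^bsub>G i\<^esub> g)" j
        "inv\<^bsub>G' j\<^esub> (f j (?q j)) \<otimes>\<^bsub>G' j\<^esub> f j (?q j \<otimes>\<^bsub>G j\<^esub> h)"
        "transport (?q(i := ?q i \<otimes>\<^bsub>G i\<^esub> g, j := ?q j \<otimes>\<^bsub>G j\<^esub> h)) v" V G' E]
    by (simp add: transport_append fun_upd_twist)
qed

lemma transport_append_conv:
  "transport p w = a @ b \<Longrightarrow>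
    \<exists>u v. w = u @ v \<and> transport p u = a \<and> transport (advance p u) v = b"
proof (induction p w arbitrary: a rule: transport.induct)
  case (2 p i g w)
  show ?case
  proof (cases a)
    case Nil
    then show ?thesis using 2 by (intro exI[of _ "[]"] exI[of _ "(i, g) # w"]) simp
  next
    case (Cons x a')
    then obtain u v where "w = u @ v" "transport (p(i := p i \<otimes>\<^bsub>G i\<^esub> g)) u = a'"
      "transport (advance (p(i := p i \<otimes>\<^bsub>G i\<^esub> g)) u) v = b"
      using "2.IH"[of a'] "2.prems" by (auto simp del: fun_upd_apply)
    then show ?thesis using Cons "2.prems"
      by (intro exI[of _ "(i, g) # u"] exI[of _ v]) simp
  qed
qed simp

lemma transport_Cons_conv:
  "transport p w = (i, g') # b \<Longrightarrow>
    \<exists>g v. w = (i, g) # v \<and> g' = inv\<^bsub>G' i\<^esub> (f i (p i)) \<otimes>\<^bsub>G' i\<^esub> f i (p i \<otimes>\<^bsub>G i\<^esub> g)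
      \<and> b = transport (p(i := p i \<otimes>\<^bsub>G i\<^esub> g)) v"
  by (cases w) auto

lemma transport_split:
  assumes "transport p w = a @ (i, g') # b"
  obtains x g y where "w = x @ (i, g) # y" "transport p x = a"
    "g' = inv\<^bsub>G' i\<^esub> (f i (advance p x i)) \<otimes>\<^bsub>G' i\<^esub> f i (advance p x i \<otimes>\<^bsub>G i\<^esub> g)"
    "b = transport ((advance p x)(i := advance p x i \<otimes>\<^bsub>G i\<^esub> g)) y"
proof -
  obtain x v where x: "w = x @ v" "transport p x = a" "transport (advance p x) v = (i, g') # b"
    using transport_append_conv[OF assms] by blast
  with transport_Cons_conv[OF x(3)] show thesis by (auto intro: that)
qed

text \<open>
  The one place where injectivity enters: a nontrivial syllable is never sent to a trivial one.
\<close>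

lemma transport_trivial_syllable:
  assumes "i \<in> V" "x \<in> carrier (G i)" "g \<in> carrier (G i)"
    and "inv\<^bsub>G' i\<^esub> (f i x) \<otimes>\<^bsub>G' i\<^esub> f i (x \<otimes>\<^bsub>G i\<^esub> g) = \<one>\<^bsub>G' i\<^esub>"
  shows "g = \<one>\<^bsub>G i\<^esub>"
proof -
  interpret D: group "G i" using assms by (simp add: dom.vertex_group)
  interpret C: group "G' i" using assms by (simp add: cod.vertex_group)
  have "f i (x \<otimes>\<^bsub>G i\<^esub> g) = f i x"
    using assms C.inv_solve_left[of "\<one>\<^bsub>G' i\<^esub>" "f i x" "f i (x \<otimes>\<^bsub>G i\<^esub> g)"] by simp
  then have "x \<otimes>\<^bsub>G i\<^esub> g = x"
    using assms f_inj[of i] by (auto dest: inj_onD)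
  then show ?thesis using assms by simp
qed

text \<open>
  Every move on the image of a word is the image of a move on the word itself. Merges and exchanges
  depend on the vertices only, and removals are covered by \<open>transport_trivial_syllable\<close>.
\<close>

lemma transport_move_lift:
  assumes move: "elementary_move V E G' (transport p u) w'" and "state p" "u \<in> dom.W"
  shows "\<exists>v. elementary_move V E G u v \<and> w' = transport p v"
  using move
proof (cases rule: elementary_move.cases)
  case cancel
  then show ?thesis
  proof (cases rule: cancel_move.cases)
    case (remove a i b)
    from transport_split[OF remove(1)] obtain x g y
      where u: "u = x @ (i, g) # y" "transport p x = a"
      "\<one>\<^bsub>G' i\<^esub> = inv\<^bsub>G' i\<^esub> (f i (advance p x i)) \<otimes>\<^bsub>G' i\<^esub> f i (advance p x i \<otimes>\<^bsub>G i\<^esub> g)"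
      "b = transport ((advance p x)(i := advance p x i \<otimes>\<^bsub>G i\<^esub> g)) y"
      by blast
    have q: "state (advance p x)" "i \<in> V" "g \<in> carrier (G i)" using u(1) assms by auto
    have g: "g = \<one>\<^bsub>G i\<^esub>"
      using q by (intro transport_trivial_syllable[OF q(2) _ q(3) u(3)[symmetric]]) simp
    have "elementary_move V E G u (x @ y)"
      using u g assms cancel_move.remove[of x i G y V] by (auto intro: elementary_move.cancel)
    moreover have "w' = transport p (x @ y)"
      using remove(2) u(2,4) g q by (simp add: transport_append)
    ultimately show ?thesis by blast
  next
    case (merge a i g' h' b)
    from transport_split[OF merge(1)] obtain x g v
      where x: "u = x @ (i, g) # v" "transport p x = a"
      "g' = inv\<^bsub>G' i\<^esub> (f i (advance p x i)) \<otimes>\<^bsub>G' i\<^esub> f i (advance p x i \<otimes>\<^bsub>G i\<^esub> g)"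
      "transport ((advance p x)(i := advance p x i \<otimes>\<^bsub>G i\<^esub> g)) v = (i, h') # b"
      by metis
    from transport_Cons_conv[OF x(4)] obtain h y where y: "v = (i, h) # y"
      "h' = inv\<^bsub>G' i\<^esub> (f i (advance p x i \<otimes>\<^bsub>G i\<^esub> g))
            \<otimes>\<^bsub>G' i\<^esub> f i (advance p x i \<otimes>\<^bsub>G i\<^esub> g \<otimes>\<^bsub>G i\<^esub> h)"
      "b = transport ((advance p x)(i := advance p x i \<otimes>\<^bsub>G i\<^esub> g \<otimes>\<^bsub>G i\<^esub> h)) y"
      by auto
    have u: "u = x @ (i, g) # (i, h) # y" using x y by simp
    have q: "state (advance p x)" "i \<in> V" "g \<in> carrier (G i)" "h \<in> carrier (G i)"
      using u assms by auto
    have "elementary_move V E G u (x @ (i, g \<otimes>\<^bsub>G i\<^esub> h) # y)"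
      using u assms cancel_move.merge[of x i g h y V G] by (auto intro: elementary_move.cancel)
    moreover have "w' = transport p (x @ (i, g \<otimes>\<^bsub>G i\<^esub> h) # y)"
      using merge(2) x(2,3) y(2,3) q
      by (simp add: transport_append dom.vertex_assoc cod.telescope)
    ultimately show ?thesis by blast
  qed
next
  case (exchange a i g' j h' b)
  have "i \<noteq> j" using exchange(4) dom.edge_vertices by blast
  from transport_split[OF exchange(1)] obtain x g v
    where x: "u = x @ (i, g) # v" "transport p x = a"
    "g' = inv\<^bsub>G' i\<^esub> (f i (advance p x i)) \<otimes>\<^bsub>G' i\<^esub> f i (advance p x i \<otimes>\<^bsub>G i\<^esub> g)"
    "transport ((advance p x)(i := advance p x i \<otimes>\<^bsub>G i\<^esub> g)) v = (j, h') # b"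
    by metis
  from transport_Cons_conv[OF x(4)] \<open>i \<noteq> j\<close> obtain h y where y: "v = (j, h) # y"
    "h' = inv\<^bsub>G' j\<^esub> (f j (advance p x j)) \<otimes>\<^bsub>G' j\<^esub> f j (advance p x j \<otimes>\<^bsub>G j\<^esub> h)"
    "b = transport ((advance p x)(i := advance p x i \<otimes>\<^bsub>G i\<^esub> g, j := advance p x j \<otimes>\<^bsub>G j\<^esub> h)) y"
    by auto
  have u: "u = x @ (i, g) # (j, h) # y" using x y by simp
  have "elementary_move V E G u (x @ (j, h) # (i, g) # y)"
    using u assms exchange(4) elementary_move.exchange[of x i g j h y V G E] by simp
  moreover have "w' = transport p (x @ (j, h) # (i, g) # y)"
    using exchange(2) x(2,3) y(2,3) \<open>i \<noteq> j\<close> by (simp add: transport_append fun_upd_twist)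
  ultimately show ?thesis by blast
qed

lemma transport_moves_lift:
  assumes "(elementary_move V E G')\<^sup>*\<^sup>* (transport p u) w'" "state p" "u \<in> dom.W"
  shows "\<exists>v. (elementary_move V E G)\<^sup>*\<^sup>* u v \<and> w' = transport p v"
  using assms(1)
proof (induction rule: rtranclp_induct)
  case (step y z)
  then obtain v where v: "(elementary_move V E G)\<^sup>*\<^sup>* u v" "y = transport p v" by blast
  have "v \<in> dom.W" using v(1) assms(3) by (rule dom.elementary_moves_words)
  then obtain v' where "elementary_move V E G v v'" "z = transport p v'"
    using transport_move_lift[of p v z] step.hyps(2) assms(2) v(2) by blast
  with v show ?case by (blast intro: rtranclp.rtrancl_into_rtrancl)
qed auto

lemma normal_form_transport:
  assumes "normal_form V E G w" "state p"
  shows "normal_form V E G' (transport p w)"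
  using assms transport_moves_lift[of p w] by (force simp: normal_form_def)

lemma transport_word_equiv:
  "\<lbrakk>dom.word_equiv E u v; state p\<rbrakk> \<Longrightarrow> cod.word_equiv E (transport p u) (transport p v)"
  by (induction rule: equivclp_induct) (auto intro: equivclp_into_equivclp transport_move)

text \<open>
  Words representing the same element have equivalent images, so the description in
  \<open>Phi\<close> singles out a value.
\<close>

lemma Phi_gp_class:
  assumes "w \<in> dom.W"
  shows "Phi V E G G' f (dom.gp_class w) = cod.gp_class (transport start w)"
  unfolding Phi_def
proof (rule the_equality)
  show "\<forall>u\<in>dom.W. dom.gp_class u = dom.gp_class w \<longrightarrow>
      cod.gp_class (transport start w) = cod.gp_class (Phi_word G G' f u)"
    using assms
    by (auto simp: Phi_word_eq_transport dom.gp_class_eq_iff cod.gp_class_eq_iff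
        intro: transport_word_equiv equivclp_sym)
qed (use assms in \<open>auto simp: Phi_word_eq_transport\<close>)

lemma transport_kernel_words: "w \<in> dom.kernel_words \<Longrightarrow> transport start w \<in> cod.kernel_words"
  by (simp add: dom.kernel_words_def cod.kernel_words_def sp_transport)

text \<open>
  A word of the kernel returns the state to the identities.
\<close>

lemma transport_kernel_append:
  assumes "u \<in> dom.kernel_words" "v \<in> dom.W"
  shows "transport start (u @ v) = transport start u @ transport start v"
proof -
  have "transport (advance start u) v = transport start v"
    using assms by (intro transport_cong) (auto simp: advance_eq dom.kernel_words_def)
  then show ?thesis by (simp add: transport_append)
qed

lemma Phi_mult:
  assumes "u \<in> dom.kernel_words" "v \<in> dom.kernel_words"
  shows "Phi V E G G' f (dom.gp_class (u @ v))
       = Phi V E G G' f (dom.gp_class u) \<otimes>\<^bsub>cod.GP\<^esub> Phi V E G G' f (dom.gp_class v)"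
  using assms
  by (simp add: Phi_gp_class dom.kernel_words_W transport_kernel_append cod.gp_class_append)

text \<open>
  Take a normal form; its image is a normal form of the same length.
\<close>

lemma nl_Phi:
  assumes "w \<in> dom.W"
  shows "nl V E G' (Phi V E G G' f (dom.gp_class w)) = nl V E G (dom.gp_class w)"
proof -
  obtain v where v: "normal_form V E G v" "dom.word_equiv E w v"
    using dom.normal_form_exists[OF assms] by blast
  then have "v \<in> dom.W" by (simp add: normal_form_def)
  have eq: "dom.gp_class w = dom.gp_class v"
    using v assms by (intro dom.word_equiv_gp_class)
  show ?thesis
    unfolding eq Phi_gp_class[OF \<open>v \<in> dom.W\<close>]
    using v by (simp add: cod.nl_eq_length dom.nl_eq_length normal_form_transport)
qed

lemma Phi_hom:
  "Phi V E G G' f \<in> hom (dom.GP\<lparr>carrier := K_graph V E G\<rparr>) (cod.GP\<lparr>carrier := K_graph V E G'\<rparr>)"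
proof (rule homI)
  fix x assume "x \<in> carrier (dom.GP\<lparr>carrier := K_graph V E G\<rparr>)"
  then show "Phi V E G G' f x \<in> carrier (cod.GP\<lparr>carrier := K_graph V E G'\<rparr>)"
    by (auto simp: dom.K_graph_eq cod.K_graph_eq Phi_gp_class dom.kernel_words_W
        transport_kernel_words)
next
  fix x y
  assume "x \<in> carrier (dom.GP\<lparr>carrier := K_graph V E G\<rparr>)"
    "y \<in> carrier (dom.GP\<lparr>carrier := K_graph V E G\<rparr>)"
  then obtain u v where "u \<in> dom.kernel_words" "v \<in> dom.kernel_words"
    "x = dom.gp_class u" "y = dom.gp_class v"
    by (auto simp: dom.K_graph_eq)
  then show "Phi V E G G' f (x \<otimes>\<^bsub>dom.GP\<lparr>carrier := K_graph V E G\<rparr>\<^esub> y)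
    = Phi V E G G' f x \<otimes>\<^bsub>cod.GP\<lparr>carrier := K_graph V E G'\<rparr>\<^esub> Phi V E G G' f y"
    by (simp add: dom.gp_class_append dom.kernel_words_W Phi_mult)
qed

lemma Phi_inverse:
  assumes "u \<in> dom.kernel_words"
  shows "Phi V E G G' f (dom.gp_class (dom.inverse_word u))
       = inv\<^bsub>cod.GP\<^esub> (Phi V E G G' f (dom.gp_class u))"
proof (rule group.inv_equality[OF cod.group_graph_product, symmetric])
  have u: "u \<in> dom.W" "dom.inverse_word u \<in> dom.kernel_words"
    using assms by (auto simp: dom.kernel_words_W dom.kernel_words_inverse)
  have "dom.gp_class (dom.inverse_word u @ u) = dom.gp_class []"
    using u by (simp add: dom.gp_class_eq_iff dom.word_equiv_l_inverse)
  then show "Phi V E G G' f (dom.gp_class (dom.inverse_word u))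
      \<otimes>\<^bsub>cod.GP\<^esub> Phi V E G G' f (dom.gp_class u) = \<one>\<^bsub>cod.GP\<^esub>"
    using Phi_mult[OF u(2) assms] by (simp add: Phi_gp_class cod.gp_one)
qed (use assms in \<open>auto simp: Phi_gp_class dom.kernel_words_W\<close>)

lemma Phi_isometric:
  "isometric_embedding (K_graph V E G) (d_nl V E G) (K_graph V E G') (d_nl V E G')
     (Phi V E G G' f)"
  unfolding isometric_embedding_def
proof (intro conjI ballI)
  show "Phi V E G G' f \<in> K_graph V E G \<rightarrow> K_graph V E G'"
    using Phi_hom by (auto simp: hom_def)
next
  fix x y assume "x \<in> K_graph V E G" "y \<in> K_graph V E G"
  then obtain u v where uv: "u \<in> dom.kernel_words" "v \<in> dom.kernel_words"
    "x = dom.gp_class u" "y = dom.gp_class v"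
    by (auto simp: dom.K_graph_eq)
  let ?w = "dom.inverse_word u @ v"
  have "inv\<^bsub>dom.GP\<^esub> x \<otimes>\<^bsub>dom.GP\<^esub> y = dom.gp_class ?w"
    using uv by (simp add: dom.gp_inv dom.gp_class_append dom.kernel_words_W)
  moreover have "inv\<^bsub>cod.GP\<^esub> (Phi V E G G' f x) \<otimes>\<^bsub>cod.GP\<^esub> Phi V E G G' f y
      = Phi V E G G' f (dom.gp_class ?w)"
    using uv by (simp add: Phi_mult Phi_inverse dom.kernel_words_inverse)
  moreover have "?w \<in> dom.W" using uv by (simp add: dom.kernel_words_W)
  ultimately show "d_nl V E G' (Phi V E G G' f x) (Phi V E G G' f y) = d_nl V E G x y"
    by (simp add: d_nl_def nl_Phi)
qed

end

section \<open>The isometric embedding\<close>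

theorem corollary5p8:
  fixes V :: "'i set" and E :: "'i set set"
    and G :: "'i \<Rightarrow> ('a, 'm) monoid_scheme" and G' :: "'i \<Rightarrow> ('b, 'n) monoid_scheme"
    and f :: "'i \<Rightarrow> 'a \<Rightarrow> 'b"
  assumes "simplicial_graph V E"
    and "\<And>i. i \<in> V \<Longrightarrow> group (G i)"
    and "\<And>i. i \<in> V \<Longrightarrow> group (G' i)"
    and "\<And>i. i \<in> V \<Longrightarrow> f i \<in> carrier (G i) \<rightarrow> carrier (G' i)"
    and "\<And>i. i \<in> V \<Longrightarrow> inj_on (f i) (carrier (G i))"
  shows "Phi V E G G' f \<in> hom ((graph_product V E G)\<lparr>carrier := K_graph V E G\<rparr>)
                              ((graph_product V E G')\<lparr>carrier := K_graph V E G'\<rparr>)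
       \<and> isometric_embedding (K_graph V E G) (d_nl V E G) (K_graph V E G') (d_nl V E G') (Phi V E G G' f)"
proof -
  interpret vertex_injections V G G' E f
    using assms
    by (intro vertex_injections.intro graph_of_groups.intro vertex_groups.intro
        graph_of_groups_axioms.intro vertex_injections_axioms.intro)
  show ?thesis using Phi_hom Phi_isometric by blast
qed

end
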